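(* Let $T\in\mathcal{I}_A$ be an $A$-isometry of $\mathcal{H}$ and let $\mathbf{T}$ denote its isometric extension to $\mathcal{L}$. The following are equivalent: (1) $T$ is $A$-adjointable; (2) $\mathbf{T}^*(\mathcal{H})\subset\mathcal{H}$; (3) the range $R(T)$ is an $A$-compatible subspace of $\mathcal{H}$; (4) $R(T^*A)=R(A)$; (5) there exists $\lambda>0$ such that $T^*A^2T\le\lambda A^2$.
   Context: $(\mathcal{H},\langle\cdot,\cdot\rangle)$ is a Hilbert space, $\mathcal{B}(\mathcal{H})$ its algebra of bounded operators, and $A\in\mathcal{B}(\mathcal{H})$ is a positive contraction with trivial nullspace. The $A$-inner product is $\langle f,g\rangle_A=\langle Af,g\rangle$ for $f,g\in\mathcal{H}$. $\mathcal{L}$ is the Hilbert space completion of the pre-Hilbert space $(\mathcal{H},\langle\cdot,\cdot\rangle_A)$; $\mathcal{H}$ is regarded as a dense subspace of $\mathcal{L}$. $\mathcal{I}_A$ is the set of $A$-isometries, i.e. operators $T\in\mathcal{B}(\mathcal{H})$ with $T^*AT=A$ (equivalently $\langle Tf,Tg\rangle_A=\langle f,g\rangle_A$ for all $f,g\in\mathcal{H}$). Each $T\in\mathcal{I}_A$ extends uniquely to an isometry $\mathbf{T}\in\mathcal{B}(\mathcal{L})$; $\mathbf{T}^*$ is its adjoint in $\mathcal{L}$, while $T^*$ is the adjoint of $T$ in $(\mathcal{H},\langle\cdot,\cdot\rangle)$. An operator $B\in\mathcal{B}(\mathcal{H})$ is $A$-adjointable if there exists $S\in\mathcal{B}(\mathcal{H})$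 with $\langle Bf,g\rangle_A=\langle f,Sg\rangle_A$ for all $f,g\in\mathcal{H}$. A closed subspace $\mathcal{S}\subset\mathcal{H}$ is $A$-compatible if it admits a (closed) supplement in $\mathcal{H}$ that is orthogonal to $\mathcal{S}$ for $\langle\cdot,\cdot\rangle_A$; equivalently, $\mathcal{S}$ is the range of some $Q\in\mathcal{B}(\mathcal{H})$ with $Q^2=Q$ and $Q^*A=AQ$. $R(\cdot)$ denotes range. *)

theory Defs
  imports "HOL-Analysis.Analysis"
begin

text \<open>
  Complex Hilbert spaces, as type classes on top of the real normed spaces of the library.
  The inner product is linear in its first argument.
\<close>

class complex_vector = real_vector +
  fixes scaleC :: "complex \<Rightarrow> 'a \<Rightarrow> 'a" (infixr "*\<^sub>C" 75)
  assumes scaleC_of_real: "scaleC (complex_of_real r) x = scaleR r x"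
    and scaleC_add_right: "scaleC a (x + y) = scaleC a x + scaleC a y"
    and scaleC_add_left: "scaleC (a + b) x = scaleC a x + scaleC b x"
    and scaleC_scaleC: "scaleC a (scaleC b x) = scaleC (a * b) x"

class complex_inner = complex_vector + real_normed_vector +
  fixes cinner :: "'a \<Rightarrow> 'a \<Rightarrow> complex"
  assumes cinner_commute: "cinner x y = cnj (cinner y x)"
    and cinner_add_left: "cinner (x + y) z = cinner x z + cinner y z"
    and cinner_scaleC_left: "cinner (scaleC a x) y = a * cinner x y"
    and cinner_self: "cinner x x = complex_of_real ((norm x)\<^sup>2)"

class chilbert_space = complex_inner + complete_space

definition csubspace :: "'a::complex_vector set \<Rightarrow> bool" where
  "csubspace S \<longleftrightarrow>
     0 \<in> S \<and> (\<forall>x\<in>S. \<forall>y\<in>S. x + y \<in> S) \<and> (\<forall>c. \<forall>x\<in>S. c *\<^sub>C x \<in> S)"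

definition clinear :: "('a::complex_vector \<Rightarrow> 'b::complex_vector) \<Rightarrow> bool" where
  "clinear f \<longleftrightarrow>
     (\<forall>x y. f (x + y) = f x + f y) \<and> (\<forall>c x. f (c *\<^sub>C x) = c *\<^sub>C f x)"

definition bounded_clinear :: "('a::complex_inner \<Rightarrow> 'b::complex_inner) \<Rightarrow> bool" where
  "bounded_clinear f \<longleftrightarrow> clinear f \<and> (\<exists>K. \<forall>x. norm (f x) \<le> K * norm x)"

text \<open>
  The analogue of the library's \<^const>\<open>adjoint\<close>. For a bounded operator between Hilbert spaces
  the chosen function exists and is unique.
\<close>

definition cadjoint :: "('a::chilbert_space \<Rightarrow> 'b::chilbert_space) \<Rightarrow> 'b \<Rightarrow> 'a" where
  "cadjoint f = (SOME g. \<forall>x y. cinner (f x) y = cinner x (g y))"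

text \<open>On a complex space, positivity of the quadratic form already entails self-adjointness.\<close>

definition positive_op :: "('a::chilbert_space \<Rightarrow> 'a) \<Rightarrow> bool" where
  "positive_op B \<longleftrightarrow>
     bounded_clinear B \<and> (\<forall>f. cinner (B f) f \<in> \<real> \<and> 0 \<le> Re (cinner (B f) f))"

definition op_le :: "('a::chilbert_space \<Rightarrow> 'a) \<Rightarrow> ('a \<Rightarrow> 'a) \<Rightarrow> bool" where
  "op_le B C \<longleftrightarrow> positive_op (\<lambda>f. C f - B f)"

definition contraction_op :: "('a::chilbert_space \<Rightarrow> 'a) \<Rightarrow> bool" where
  "contraction_op B \<longleftrightarrow> bounded_clinear B \<and> (\<forall>f. norm (B f) \<le> norm f)"

definition A_inner :: "('h::chilbert_space \<Rightarrow> 'h) \<Rightarrow> 'h \<Rightarrow> 'h \<Rightarrow> complex" where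
  "A_inner A f g = cinner (A f) g"

definition A_isometry :: "('h::chilbert_space \<Rightarrow> 'h) \<Rightarrow> ('h \<Rightarrow> 'h) \<Rightarrow> bool" where
  "A_isometry A T \<longleftrightarrow> bounded_clinear T \<and> cadjoint T \<circ> A \<circ> T = A"

definition A_adjointable :: "('h::chilbert_space \<Rightarrow> 'h) \<Rightarrow> ('h \<Rightarrow> 'h) \<Rightarrow> bool" where
  "A_adjointable A B \<longleftrightarrow> bounded_clinear B \<and>
     (\<exists>S. bounded_clinear S \<and> (\<forall>f g. A_inner A (B f) g = A_inner A f (S g)))"

definition A_compatible :: "('h::chilbert_space \<Rightarrow> 'h) \<Rightarrow> 'h set \<Rightarrow> bool" where
  "A_compatible A S \<longleftrightarrow> csubspace S \<and> closed S \<and>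
     (\<exists>N. csubspace N \<and> closed N \<and> S \<inter> N = {0} \<and> (\<forall>h. \<exists>s\<in>S. \<exists>n\<in>N. h = s + n) \<and>
          (\<forall>s\<in>S. \<forall>n\<in>N. A_inner A s n = 0))"

text \<open>
  The completion of the space with the \<open>A\<close>-inner product is given by a Hilbert space \<^typ>\<open>'l\<close>
  together with the embedding \<open>\<iota>\<close> as a dense subspace; the subset \<open>range \<iota>\<close> plays the role of the
  original space inside its completion.
\<close>

definition A_completion ::
    "('h::chilbert_space \<Rightarrow> 'h) \<Rightarrow> ('h \<Rightarrow> 'l::chilbert_space) \<Rightarrow> bool" where
  "A_completion A \<iota> \<longleftrightarrow> clinear \<iota> \<and>
     (\<forall>f g. cinner (\<iota> f) (\<iota> g) = A_inner A f g) \<and> closure (range \<iota>) = UNIV"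

definition isometric_extension ::
    "('h::chilbert_space \<Rightarrow> 'l::chilbert_space) \<Rightarrow> ('h \<Rightarrow> 'h) \<Rightarrow> ('l \<Rightarrow> 'l) \<Rightarrow> bool" where
  "isometric_extension \<iota> T V \<longleftrightarrow> bounded_clinear V \<and> (\<forall>x. norm (V x) = norm x) \<and>
     (\<forall>f. V (\<iota> f) = \<iota> (T f))"

end

theory Submission
  imports Defs
begin

text \<open>
  All five conditions are compared with the pointwise condition that for every \<open>g\<close> there is an \<open>s\<close>
  with \<open>\<langle>A T f, g\<rangle> = \<langle>A f, s\<rangle>\<close> for all \<open>f\<close>. It says that the vectors \<open>A T f\<close> with \<open>\<parallel>A f\<parallel> \<le> 1\<close>
  form a weakly bounded set, so by uniform boundedness \<open>\<parallel>A T f\<parallel> \<le> K \<parallel>A f\<parallel>\<close>, which is (5).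
  Conversely, under (5) the functional \<open>A f \<mapsto> \<langle>A T f, g\<rangle>\<close> on the range of \<open>A\<close> is bounded, and Riesz
  representation produces \<open>s\<close> with \<open>\<parallel>s\<parallel> \<le> K \<parallel>g\<parallel>\<close>; as \<open>A\<close> is injective, \<open>s\<close> depends linearly
  on \<open>g\<close>, so that \<open>g \<mapsto> s\<close> is a bounded \<open>A\<close>-adjoint of \<open>T\<close>.
\<close>

section \<open>Complex inner products\<close>

lemma scaleC_one [simp]: "1 *\<^sub>C x = x"
  by (metis of_real_1 scaleC_of_real scaleR_one)

lemma cinner_add_right: "cinner x (y + z) = cinner x y + cinner x z"
  by (metis cinner_add_left cinner_commute complex_cnj_add)

lemma cinner_scaleC_right: "cinner x (a *\<^sub>C y) = cnj a * cinner x y"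
  by (metis cinner_commute cinner_scaleC_left complex_cnj_mult)

lemma cinner_scaleR_left: "cinner (r *\<^sub>R x) y = of_real r * cinner x y"
  by (metis cinner_scaleC_left scaleC_of_real)

lemma cinner_scaleR_right: "cinner x (r *\<^sub>R y) = of_real r * cinner x y"
  by (metis cinner_scaleC_right complex_cnj_complex_of_real scaleC_of_real)

lemma cinner_diff_left: "cinner (x - y) z = cinner x z - cinner y z"
  by (metis add_diff_cancel_right' cinner_add_left diff_add_cancel)

lemma cinner_diff_right: "cinner x (y - z) = cinner x y - cinner x z"
  by (metis add_diff_cancel_right' cinner_add_right diff_add_cancel)

lemma cinner_zero_left [simp]: "cinner 0 x = 0"
  by (metis cinner_diff_left diff_self)

lemma cinner_zero_right [simp]: "cinner x 0 = 0"
  by (metis cinner_diff_right diff_self)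

lemma cinner_left_eqI:
  assumes "\<And>x. cinner x y = cinner x z"
  shows "y = z"
proof -
  have "cinner (y - z) (y - z) = 0"
    using assms by (simp add: cinner_diff_right)
  then show ?thesis by (simp add: cinner_self)
qed

lemma Re_cinner_commute: "Re (cinner y x) = Re (cinner x y)"
  by (subst cinner_commute) simp

lemma Re_cinner_self: "Re (cinner x x) = (norm x)\<^sup>2"
  by (simp add: cinner_self)

lemma power2_norm_add: "(norm (x + y))\<^sup>2 = (norm x)\<^sup>2 + 2 * Re (cinner x y) + (norm y)\<^sup>2"
  for x y :: "'a::complex_inner"
  using Re_cinner_commute[of x y]
  by (simp add: Re_cinner_self[symmetric] cinner_add_left cinner_add_right)

text \<open>The axioms for the norm speak of real scalars; complex ones enter through
  \<open>cinner_self\<close>, so the factor is read off from squares.\<close>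

lemma norm_scaleC: "norm (a *\<^sub>C x) = cmod a * norm x" for x :: "'a::complex_inner"
proof -
  have "complex_of_real ((norm (a *\<^sub>C x))\<^sup>2) = complex_of_real ((cmod a * norm x)\<^sup>2)"
    by (simp only: cinner_self[symmetric] cinner_scaleC_left cinner_scaleC_right power_mult_distrib
        of_real_mult complex_norm_square ac_simps)
  then show ?thesis
    by (simp only: of_real_eq_iff power2_eq_iff_nonneg norm_ge_zero mult_nonneg_nonneg)
qed

lemma cinner_Cauchy_Schwarz: "cmod (cinner x y) \<le> norm x * norm y"
proof (cases "y = 0")
  case False
  \<comment> \<open>This scalar makes \<open>x + c *\<^sub>C y\<close> orthogonal to
    \<open>y\<close>, which minimizes its norm over all scalars.\<close>
  define c where "c = - (cinner x y / of_real ((norm y)\<^sup>2))"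
  have "0 \<le> (norm (x + c *\<^sub>C y))\<^sup>2" by simp
  also have "\<dots> = (norm x)\<^sup>2 + 2 * Re (cnj c * cinner x y) + (cmod c * norm y)\<^sup>2"
    by (simp add: power2_norm_add cinner_scaleC_right norm_scaleC)
  also have "Re (cnj c * cinner x y) = - ((cmod (cinner x y))\<^sup>2 / (norm y)\<^sup>2)"
  proof -
    have "cnj c * cinner x y = - (of_real ((cmod (cinner x y))\<^sup>2) / of_real ((norm y)\<^sup>2))"
      unfolding c_def complex_norm_square by (simp add: mult.commute)
    also have "\<dots> = of_real (- ((cmod (cinner x y))\<^sup>2 / (norm y)\<^sup>2))" by simp
    finally show ?thesis by (simp only: Re_complex_of_real)
  qed
  also have "(cmod c * norm y)\<^sup>2 = (cmod (cinner x y))\<^sup>2 / (norm y)\<^sup>2"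
    using False by (simp add: c_def norm_divide norm_mult power_divide field_simps power2_eq_square)
  finally have "(cmod (cinner x y))\<^sup>2 \<le> (norm x * norm y)\<^sup>2"
    using False by (simp add: field_simps)
  then show ?thesis by (rule power2_le_imp_le) simp
qed simp

lemma bounded_bilinear_cinner: "bounded_bilinear (cinner :: 'a::complex_inner \<Rightarrow> 'a \<Rightarrow> complex)"
proof
  show "\<exists>K. \<forall>x y::'a. cmod (cinner x y) \<le> norm x * norm y * K"
    by (rule exI[of _ 1]) (simp add: cinner_Cauchy_Schwarz)
qed (simp_all add: cinner_add_left cinner_add_right cinner_scaleR_left cinner_scaleR_right
    scaleR_conv_of_real)

lemmas tendsto_cinner = bounded_bilinear.tendsto[OF bounded_bilinear_cinner]

section \<open>Bounded operators\<close>

lemma clinear_add: "clinear f \<Longrightarrow> f (x + y) = f x + f y"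
  by (simp add: clinear_def)

lemma clinear_scaleC: "clinear f \<Longrightarrow> f (c *\<^sub>C x) = c *\<^sub>C f x"
  by (simp add: clinear_def)

lemma clinear_scaleR: "clinear f \<Longrightarrow> f (r *\<^sub>R x) = r *\<^sub>R f x"
  by (metis clinear_scaleC scaleC_of_real)

lemma clinear_imp_linear: "clinear f \<Longrightarrow> linear f"
  by (simp add: linear_iff clinear_add clinear_scaleR)

lemma bounded_clinear_imp_clinear: "bounded_clinear f \<Longrightarrow> clinear f"
  by (simp add: bounded_clinear_def)

lemma bounded_clinear_imp_bounded_linear: "bounded_clinear f \<Longrightarrow> bounded_linear f"
  by (auto simp: bounded_clinear_def bounded_linear_def bounded_linear_axioms_def
      clinear_imp_linear mult.commute)

text \<open>Reduces closure properties of \<open>bounded_clinear\<close> to those known for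
  \<open>bounded_linear\<close>.\<close>

lemma bounded_clinear_iff: "bounded_clinear f \<longleftrightarrow> clinear f \<and> bounded_linear f"
  using bounded_clinear_imp_bounded_linear bounded_clinear_imp_clinear
    bounded_linear.bounded[of f]
  by (metis bounded_clinear_def mult.commute)

lemma bounded_clinear_compose:
  assumes "bounded_clinear f" "bounded_clinear g"
  shows "bounded_clinear (\<lambda>x. f (g x))"
  using assms bounded_linear_compose[of f g]
  by (auto simp: bounded_clinear_iff clinear_def)

lemma scaleC_diff_right: "c *\<^sub>C (x - y) = c *\<^sub>C x - c *\<^sub>C y"
  by (metis add_diff_cancel_right' diff_add_cancel scaleC_add_right)

lemma scaleC_scaleR_commute: "c *\<^sub>C r *\<^sub>R x = r *\<^sub>R c *\<^sub>C x"
  by (metis mult.commute scaleC_of_real scaleC_scaleC)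

lemma bounded_clinear_diff:
  assumes "bounded_clinear f" "bounded_clinear g"
  shows "bounded_clinear (\<lambda>x. f x - g x)"
  using assms bounded_linear_sub[of f g]
  by (auto simp: bounded_clinear_iff clinear_def scaleC_diff_right)

lemma bounded_clinear_scaleR:
  assumes "bounded_clinear f"
  shows "bounded_clinear (\<lambda>x. r *\<^sub>R f x)"
  using assms bounded_linear_const_scaleR[of f r]
  by (auto simp: bounded_clinear_iff clinear_def scaleC_scaleR_commute scaleR_add_right)

lemma csubspace_range: "clinear f \<Longrightarrow> csubspace (range f)"
  unfolding csubspace_def
  by (auto simp: clinear_add[symmetric] clinear_scaleC[symmetric]
      intro: rangeI range_eqI[of _ _ 0] simp: linear_0[OF clinear_imp_linear])

lemma csubspace_kernel: "clinear f \<Longrightarrow> csubspace {x. f x = 0}"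
  using linear_0[OF clinear_imp_linear, of f]
  by (auto simp: csubspace_def clinear_add clinear_scaleC)
     (metis add.right_neutral add_left_cancel scaleC_add_right)

section \<open>Riesz representation\<close>

text \<open>
  The functional \<open>B f \<mapsto> \<phi> f\<close> need only be defined on the range of \<open>B\<close>, which is not assumed closed
  or dense. The representing vector is the limit of a minimizing sequence of
  \<open>\<parallel>B f\<parallel>\<^sup>2 - 2 Re (\<phi> f)\<close>, and hence lies in the closure of that range, so its norm is at most \<open>K\<close>.
\<close>

lemma Riesz_representation_range:
  fixes B :: "'a::complex_vector \<Rightarrow> 'h::chilbert_space" and \<phi> :: "'a \<Rightarrow> complex"
  assumes B: "clinear B"
    and add: "\<And>f g. \<phi> (f + g) = \<phi> f + \<phi> g" and scale: "\<And>c f. \<phi> (c *\<^sub>C f) = c * \<phi> f"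
    and bound: "\<And>f. cmod (\<phi> f) \<le> K * norm (B f)" and "0 \<le> K"
  shows "\<exists>y. (\<forall>f. \<phi> f = cinner (B f) y) \<and> norm y \<le> K"
proof -
  define J where "J f = (norm (B f))\<^sup>2 - 2 * Re (\<phi> f)" for f
  have scaleR: "\<phi> (r *\<^sub>R f) = of_real r * \<phi> f" for r f
    by (metis scale scaleC_of_real)
  \<comment> \<open>Completing the square: \<open>J f\<close> is at least
    \<open>(norm (B f) - K)\<^sup>2 - K\<^sup>2\<close>.\<close>
  have lower: "- K\<^sup>2 \<le> J f" for f
  proof -
    have "Re (\<phi> f) \<le> K * norm (B f)"
      using bound[of f] complex_Re_le_cmod[of "\<phi> f"] by linarith
    moreover have "0 \<le> (norm (B f) - K)\<^sup>2" by simp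
    ultimately show ?thesis
      by (simp add: J_def power2_diff algebra_simps)
  qed
  define m where "m = (INF f. J f)"
  have m: "m \<le> J f" for f
    unfolding m_def by (rule cINF_lower) (auto intro!: bdd_belowI lower)
  have "\<exists>f. J f < m + 1 / real (Suc n)" for n
    using cInf_lessD[of "range J" "m + 1 / real (Suc n)"] by (auto simp: m_def)
  then obtain u where u: "\<And>n. J (u n) < m + 1 / real (Suc n)" by metis
  have Jlim: "(\<lambda>n. J (u n)) \<longlonglongrightarrow> m"
  proof (rule tendsto_sandwich[of "\<lambda>_. m" _ _ "\<lambda>n. m + 1 / real (Suc n)"])
    show "(\<lambda>n. m + 1 / real (Suc n)) \<longlonglongrightarrow> m"
      using tendsto_add[OF tendsto_const LIMSEQ_inverse_real_of_nat, of m]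
      by (simp add: inverse_eq_divide)
  qed (use m u in \<open>auto intro!: always_eventually less_imp_le simp del: of_nat_Suc\<close>)
  \<comment> \<open>Along a line \<open>J\<close> is a quadratic polynomial in \<open>r\<close>. Its
    values at \<open>1\<close> and \<open>1/2\<close> give the parallelogram estimate; its limit
    along the minimizing sequence gives the first variation.\<close>
  have expand: "J (f + r *\<^sub>R g) =
      J f + 2 * r * (Re (cinner (B f) (B g)) - Re (\<phi> g)) + r\<^sup>2 * (norm (B g))\<^sup>2" for f g r
    by (simp add: J_def clinear_add[OF B] clinear_scaleR[OF B] power2_norm_add cinner_scaleR_right
        add scaleR power_mult_distrib algebra_simps)
  \<comment> \<open>At the midpoint of \<open>f\<close> and \<open>g\<close> the value of
    \<open>J\<close> is still at least \<open>m\<close>, so near-minimizers have nearby images under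
    \<open>B\<close>.\<close>
  have parallelogram: "(norm (B f - B g))\<^sup>2 \<le> 2 * (J f - m) + 2 * (J g - m)" for f g
  proof -
    have "B (f - g) = B f - B g" by (rule linear_diff[OF clinear_imp_linear[OF B]])
    then have "2 * J f + 2 * J g - 4 * J (g + (1/2) *\<^sub>R (f - g)) = (norm (B f - B g))\<^sup>2"
      using expand[of g 1 "f - g"] expand[of g "1/2" "f - g"]
      by (simp add: power2_eq_square)
    with m[of "g + (1/2) *\<^sub>R (f - g)"] show ?thesis by (simp add: algebra_simps)
  qed
  have "Cauchy (\<lambda>n. B (u n))"
  proof (rule metric_CauchyI)
    fix e :: real assume "0 < e"
    then have "\<forall>\<^sub>F n in sequentially. J (u n) < m + e\<^sup>2 / 4"
      by (intro order_tendstoD(2)[OF Jlim]) simp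
    then obtain N where N: "\<And>n. n \<ge> N \<Longrightarrow> J (u n) < m + e\<^sup>2 / 4"
      by (auto simp: eventually_sequentially)
    have "dist (B (u i)) (B (u j)) < e" if "i \<ge> N" "j \<ge> N" for i j
    proof -
      have "(norm (B (u i) - B (u j)))\<^sup>2 < e\<^sup>2"
        using parallelogram[of "u i" "u j"] N[OF that(1)] N[OF that(2)]
        by (simp add: field_simps)
      then show ?thesis
        using \<open>0 < e\<close> by (simp add: dist_norm power_less_imp_less_base)
    qed
    then show "\<exists>N. \<forall>i\<ge>N. \<forall>j\<ge>N. dist (B (u i)) (B (u j)) < e" by blast
  qed
  then obtain y where y: "(\<lambda>n. B (u n)) \<longlonglongrightarrow> y"
    using Cauchy_convergent convergent_def by blast
  have Re_eq: "Re (\<phi> g) = Re (cinner (B g) y)" for g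
  proof -
    \<comment> \<open>Half the derivative at \<open>r = 0\<close> of the limit of
      \<open>J (u n + r *\<^sub>R g)\<close>. That limit is quadratic in \<open>r\<close> and has
      its minimum \<open>m\<close> at \<open>r = 0\<close>, so \<open>d\<close> must vanish.\<close>
    define d where "d = Re (cinner y (B g)) - Re (\<phi> g)"
    have nonneg: "0 \<le> 2 * r * d + r\<^sup>2 * (norm (B g))\<^sup>2" for r
    proof -
      have "(\<lambda>n. J (u n + r *\<^sub>R g)) \<longlonglongrightarrow> m + 2 * r * d + r\<^sup>2 * (norm (B g))\<^sup>2"
        unfolding expand d_def
        by (intro tendsto_intros Jlim tendsto_cinner y)
      then have "m \<le> m + 2 * r * d + r\<^sup>2 * (norm (B g))\<^sup>2"
        by (rule LIMSEQ_le_const) (use m in auto)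
      then show ?thesis by simp
    qed
    have "d = 0"
    proof -
      \<comment> \<open>The test value is \<open>r = - d / ?q\<close>; the added \<open>1\<close>
        keeps the denominator positive when \<open>B g = 0\<close>.\<close>
      let ?q = "(norm (B g))\<^sup>2 + 1"
      have q: "0 < ?q" by (simp add: add_nonneg_pos)
      have "0 \<le> 2 * (- d / ?q) * d + (- d / ?q)\<^sup>2 * (norm (B g))\<^sup>2" by (rule nonneg)
      also have "\<dots> \<le> 2 * (- d / ?q) * d + (- d / ?q)\<^sup>2 * ?q"
        by (intro add_left_mono mult_left_mono) auto
      also have "\<dots> = - (d\<^sup>2 / ?q)"
        using q by (simp add: divide_simps power2_eq_square)
      finally show "d = 0"
        using q by (auto simp: divide_le_0_iff power2_eq_square mult_le_0_iff not_le)
    qed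
    then show ?thesis by (simp add: d_def Re_cinner_commute)
  qed
  \<comment> \<open>The real parts at \<open>\<i> *\<^sub>C g\<close> are the negated imaginary
    parts at \<open>g\<close>.\<close>
  have eq: "\<phi> g = cinner (B g) y" for g
  proof (rule complex_eqI)
    show "Im (\<phi> g) = Im (cinner (B g) y)"
      using Re_eq[of "\<i> *\<^sub>C g"] by (simp add: scale clinear_scaleC[OF B] cinner_scaleC_left)
  qed (rule Re_eq)
  \<comment> \<open>The bound \<open>cmod (cinner (B (u n)) y) \<le> K * norm (B (u n))\<close>
    passes to the limit.\<close>
  have "cmod (cinner y y) \<le> K * norm y"
    by (rule LIMSEQ_le[OF tendsto_norm[OF tendsto_cinner[OF y tendsto_const]]
          tendsto_mult[OF tendsto_const tendsto_norm[OF y]]])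
       (use bound in \<open>auto simp: eq\<close>)
  then have "norm y * norm y \<le> K * norm y"
    by (simp add: cinner_self norm_power power2_eq_square norm_mult)
  then have "norm y \<le> K"
    using \<open>0 \<le> K\<close> by (cases "y = 0") (auto simp: mult_le_cancel_right)
  with eq show ?thesis by blast
qed

section \<open>Adjoints and self-adjointness\<close>

lemma cinner_cadjoint:
  fixes f :: "'a::chilbert_space \<Rightarrow> 'b::chilbert_space"
  assumes f: "bounded_clinear f"
  shows "cinner (f x) y = cinner x (cadjoint f y)"
proof -
  note lin = bounded_clinear_imp_clinear[OF f]
  obtain K where K: "\<And>x. norm (f x) \<le> norm x * K" "0 < K"
    using bounded_linear.pos_bounded[OF bounded_clinear_imp_bounded_linear[OF f]] by blast
  \<comment> \<open>Riesz representation with the identity in the role of \<open>B\<close>; this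
    supplies a witness for the choice in \<open>cadjoint\<close>.\<close>
  have "\<exists>z. (\<forall>x. cinner (f x) y = cinner ((\<lambda>x. x) x) z) \<and> norm z \<le> K * norm y" for y
  proof (rule Riesz_representation_range)
    fix x
    have "cmod (cinner (f x) y) \<le> norm (f x) * norm y" by (rule cinner_Cauchy_Schwarz)
    also have "\<dots> \<le> (norm x * K) * norm y" by (intro mult_right_mono K) simp
    finally show "cmod (cinner (f x) y) \<le> (K * norm y) * norm x" by (simp add: ac_simps)
  qed (use K in \<open>simp_all add: clinear_def clinear_add[OF lin] clinear_scaleC[OF lin]
      cinner_add_left cinner_scaleC_left\<close>)
  then have "\<exists>g. \<forall>x y. cinner (f x) y = cinner x (g y)" by metis
  then have "\<forall>x y. cinner (f x) y = cinner x (cadjoint f y)"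
    unfolding cadjoint_def by (rule someI_ex)
  then show ?thesis by blast
qed

text \<open>Linearity holds because a vector is determined by its inner products. For the bound, the
  squared norm of \<open>cadjoint f y\<close> is \<open>cinner (f (cadjoint f y)) y\<close>, and one
  factor cancels.\<close>

lemma bounded_clinear_cadjoint:
  fixes f :: "'a::chilbert_space \<Rightarrow> 'b::chilbert_space"
  assumes f: "bounded_clinear f"
  shows "bounded_clinear (cadjoint f)"
  unfolding bounded_clinear_def clinear_def
proof (intro conjI allI)
  fix y z c
  show "cadjoint f (y + z) = cadjoint f y + cadjoint f z"
    by (rule cinner_left_eqI) (simp add: cinner_cadjoint[OF f, symmetric] cinner_add_right)
  show "cadjoint f (c *\<^sub>C y) = c *\<^sub>C cadjoint f y"
    by (rule cinner_left_eqI) (simp add: cinner_cadjoint[OF f, symmetric] cinner_scaleC_right)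
next
  obtain K where K: "\<And>x. norm (f x) \<le> norm x * K" "0 < K"
    using bounded_linear.pos_bounded[OF bounded_clinear_imp_bounded_linear[OF f]] by blast
  have "norm (cadjoint f y) \<le> K * norm y" for y
  proof (cases "cadjoint f y = 0")
    case False
    have "norm (cadjoint f y) * norm (cadjoint f y) = cmod (cinner (f (cadjoint f y)) y)"
      by (simp add: cinner_cadjoint[OF f] cinner_self power2_eq_square norm_mult)
    also have "\<dots> \<le> norm (f (cadjoint f y)) * norm y" by (rule cinner_Cauchy_Schwarz)
    also have "\<dots> \<le> norm (cadjoint f y) * K * norm y" by (intro mult_right_mono K) simp
    finally show ?thesis using False by (simp add: mult.assoc)
  qed (use K in simp)
  then show "\<exists>K. \<forall>y. norm (cadjoint f y) \<le> K * norm y" by blast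
qed

text \<open>Polarization: reality of the quadratic form at \<open>x + y\<close> settles the
  imaginary parts, and replacing \<open>y\<close> by \<open>\<i> *\<^sub>C y\<close> settles the
  real parts.\<close>

lemma positive_op_selfadjoint:
  fixes A :: "'h::chilbert_space \<Rightarrow> 'h"
  assumes "positive_op A"
  shows "cinner (A x) y = cinner x (A y)"
proof -
  have lin: "clinear A" and real: "\<And>f. Im (cinner (A f) f) = 0"
    using assms by (auto simp: positive_op_def bounded_clinear_def complex_is_Real_iff)
  have Im: "Im (cinner (A x) y) + Im (cinner (A y) x) = 0" for x y
    using real[of "x + y"] real[of x] real[of y]
    by (simp add: clinear_add[OF lin] cinner_add_left cinner_add_right)
  have Re: "Re (cinner (A y) x) = Re (cinner (A x) y)"
    using Im[of x "\<i> *\<^sub>C y"]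
    by (simp add: clinear_scaleC[OF lin] cinner_scaleC_left cinner_scaleC_right)
  have "cinner (A x) y = cnj (cinner (A y) x)"
    using Re Im[of x y] by (simp add: complex_eq_iff)
  also have "\<dots> = cinner x (A y)" by (rule cinner_commute[symmetric])
  finally show ?thesis .
qed

text \<open>Uniform boundedness by Baire category: the closed sets \<open>E n\<close> cover the
  complete space, so one of them contains a ball.\<close>

lemma weakly_bounded_imp_bounded:
  fixes Y :: "'h::chilbert_space set"
  assumes weak: "\<And>x. \<exists>M. \<forall>y\<in>Y. cmod (cinner y x) \<le> M"
  shows "\<exists>K. \<forall>y\<in>Y. norm y \<le> K"
proof -
  define E where "E n = {x. \<forall>y\<in>Y. cmod (cinner y x) \<le> real n}" for n
  have closed: "closed (E n)" for n
  proof -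
    have "closed {x. cmod (cinner y x) \<le> real n}" for y :: 'h
      by (intro closed_Collect_le continuous_on_norm continuous_on_const
          bounded_bilinear.continuous_on[OF bounded_bilinear_cinner] continuous_on_id)
    moreover have "E n = (\<Inter>y\<in>Y. {x. cmod (cinner y x) \<le> real n})" by (auto simp: E_def)
    ultimately show ?thesis by auto
  qed
  have cover: "(\<Union>n. E n) = UNIV"
  proof -
    have "\<exists>n. x \<in> E n" for x
    proof -
      obtain M where "\<forall>y\<in>Y. cmod (cinner y x) \<le> M" using weak by blast
      moreover obtain n where "M \<le> real n" using real_arch_simple by blast
      ultimately have "x \<in> E n" by (auto simp: E_def intro: order_trans)
      then show ?thesis ..
    qed
    then show ?thesis by blast
  qed
  have "\<exists>n. interior (E n) \<noteq> {}"
  proof (rule ccontr)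
    assume "\<not> ?thesis"
    then have "euclidean interior_of \<Union>(range E) = {}"
      using closed
      by (intro Baire_category_alt)
         (auto simp: completely_metrizable_space_euclidean)
    with cover show False by simp
  qed
  then obtain n z r where z: "cball z r \<subseteq> E n" and r: "0 < r"
    by (auto simp: mem_interior_cball)
  have "norm y \<le> 2 * real n / r" if y: "y \<in> Y" for y
  proof (cases "y = 0")
    case False
    \<comment> \<open>The multiple of \<open>y\<close> of length \<open>r\<close>: both
      \<open>z\<close> and \<open>z + v\<close> lie in the ball, and pairing \<open>y\<close> with
      their difference gives \<open>r * norm y\<close>.\<close>
    define v where "v = (r / norm y) *\<^sub>R y"
    have "norm v = r" using False r by (simp add: v_def)
    then have "z \<in> cball z r" "z + v \<in> cball z r"
      using r by (auto simp: dist_norm)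
    with z y have b: "cmod (cinner y z) \<le> real n" "cmod (cinner y (z + v)) \<le> real n"
      unfolding E_def by blast+
    have "cinner y v = of_real (r * norm y)"
      using False by (simp add: v_def cinner_scaleR_right cinner_self power2_eq_square)
    then have "r * norm y = cmod (cinner y v)" using r by (simp add: norm_mult)
    also have "\<dots> = cmod (cinner y (z + v) - cinner y z)" by (simp add: cinner_add_right)
    also have "\<dots> \<le> 2 * real n"
      using b norm_triangle_ineq4[of "cinner y (z + v)" "cinner y z"] by linarith
    finally show ?thesis using r by (simp add: field_simps)
  qed (use r in simp)
  then show ?thesis by blast
qed

section \<open>Isometries for a positive operator\<close>

text \<open>When \<open>norm (A f) \<le> 1\<close>, Cauchy-Schwarz bounds
  \<open>cinner (C f) g\<close> by \<open>norm s\<close>, where \<open>s\<close> depends on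
  \<open>g\<close> only. Uniform boundedness and rescaling of \<open>f\<close> do the rest.\<close>

lemma pointwise_adjoint_imp_dominated:
  fixes A C :: "'h::chilbert_space \<Rightarrow> 'h"
  assumes A: "clinear A" and C: "clinear C" and inj: "{f. A f = 0} = {0}"
    and ptw: "\<And>g. \<exists>s. \<forall>f. cinner (C f) g = cinner (A f) s"
  shows "\<exists>K>0. \<forall>f. norm (C f) \<le> K * norm (A f)"
proof -
  have "\<exists>M. \<forall>y\<in>{C f |f. norm (A f) \<le> 1}. cmod (cinner y g) \<le> M" for g
  proof -
    obtain s where s: "\<And>f. cinner (C f) g = cinner (A f) s" using ptw by blast
    have "cmod (cinner (C f) g) \<le> norm s" if "norm (A f) \<le> 1" for f
    proof -
      have "cmod (cinner (C f) g) \<le> norm (A f) * norm s"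
        unfolding s by (rule cinner_Cauchy_Schwarz)
      also have "\<dots> \<le> 1 * norm s" by (intro mult_right_mono that) simp
      finally show ?thesis by simp
    qed
    then show ?thesis by blast
  qed
  from weakly_bounded_imp_bounded[OF this]
  obtain K where K: "\<And>f. norm (A f) \<le> 1 \<Longrightarrow> norm (C f) \<le> K" by blast
  \<comment> \<open>The maximum ensures a positive constant, since \<open>K\<close> may be
    zero.\<close>
  have "norm (C f) \<le> max K 1 * norm (A f)" for f
  proof (cases "A f = 0")
    case True
    then have "f = 0" using inj by blast
    then show ?thesis using linear_0[OF clinear_imp_linear[OF C]] by simp
  next
    case False
    then have "norm (C ((1 / norm (A f)) *\<^sub>R f)) \<le> K"
      by (intro K) (simp add: clinear_scaleR[OF A])
    then have "norm (C f) \<le> K * norm (A f)"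
      using False by (simp add: clinear_scaleR[OF C] field_simps)
    also have "\<dots> \<le> max K 1 * norm (A f)" by (intro mult_right_mono) auto
    finally show ?thesis .
  qed
  then show ?thesis by (intro exI[of _ "max K 1"]) auto
qed

text \<open>Domination bounds the functional \<open>A f \<mapsto> cinner (C f) g\<close> by
  \<open>K * norm g\<close>. By \<open>total\<close> its representing vector is unique, so choosing
  it for each \<open>g\<close> gives a linear map.\<close>

lemma dominated_imp_bounded_factor:
  fixes A C :: "'h::chilbert_space \<Rightarrow> 'h"
  assumes A: "clinear A" and C: "clinear C" and K: "0 < K"
    and le: "\<And>f. norm (C f) \<le> K * norm (A f)"
    and total: "\<And>s. (\<And>f. cinner (A f) s = 0) \<Longrightarrow> s = 0"
  shows "\<exists>S. bounded_clinear S \<and> (\<forall>f g. cinner (C f) g = cinner (A f) (S g))"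
proof -
  have "\<exists>s. (\<forall>f. cinner (C f) g = cinner (A f) s) \<and> norm s \<le> K * norm g" for g
  proof (rule Riesz_representation_range[OF A])
    fix f
    have "cmod (cinner (C f) g) \<le> norm (C f) * norm g" by (rule cinner_Cauchy_Schwarz)
    also have "\<dots> \<le> (K * norm (A f)) * norm g" by (intro mult_right_mono le) simp
    finally show "cmod (cinner (C f) g) \<le> (K * norm g) * norm (A f)" by (simp add: ac_simps)
  qed (use K in \<open>simp_all add: clinear_add[OF C] clinear_scaleC[OF C]
      cinner_add_left cinner_scaleC_left\<close>)
  then obtain S where S: "\<And>f g. cinner (C f) g = cinner (A f) (S g)"
    and bd: "\<And>g. norm (S g) \<le> K * norm g" by metis
  have uniq: "s = t" if "\<And>f. cinner (A f) s = cinner (A f) t" for s t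
    using total[of "s - t"] that by (simp add: cinner_diff_right)
  have "clinear S"
    unfolding clinear_def
    by (intro conjI allI uniq)
       (simp_all add: S[symmetric] cinner_add_right cinner_scaleC_right)
  with S bd show ?thesis unfolding bounded_clinear_def by blast
qed

theorem theorem2p6:
  fixes A T :: "'h::chilbert_space \<Rightarrow> 'h"
    and \<iota> :: "'h \<Rightarrow> 'l::chilbert_space"
    and V :: "'l \<Rightarrow> 'l"
  assumes "positive_op A" and "contraction_op A" and "{f. A f = 0} = {0}"
    and "A_completion A \<iota>"
    and "A_isometry A T"
    and "isometric_extension \<iota> T V"
  shows "(A_adjointable A T \<longleftrightarrow> cadjoint V ` range \<iota> \<subseteq> range \<iota>) \<and>
         (A_adjointable A T \<longleftrightarrow> A_compatible A (range T)) \<and>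
         (A_adjointable A T \<longleftrightarrow> range (cadjoint T \<circ> A) = range A) \<and>
         (A_adjointable A T \<longleftrightarrow>
            (\<exists>lam::real. 0 < lam \<and>
               op_le (cadjoint T \<circ> A \<circ> A \<circ> T) (\<lambda>f. lam *\<^sub>R A (A f))))"
proof -
  have bA: "bounded_clinear A" and bT: "bounded_clinear T" and bV: "bounded_clinear V"
    and iso: "\<And>f. cadjoint T (A (T f)) = A f"
    and emb: "\<And>f g. cinner (\<iota> f) (\<iota> g) = cinner (A f) g"
    and dense: "closure (range \<iota>) = UNIV"
    and ext: "\<And>f. V (\<iota> f) = \<iota> (T f)"
    using assms by (auto simp: positive_op_def A_isometry_def isometric_extension_def
        A_completion_def A_inner_def fun_eq_iff)
  note lA = bounded_clinear_imp_clinear[OF bA] and lT = bounded_clinear_imp_clinear[OF bT]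
  note sa = positive_op_selfadjoint[OF assms(1)]
  have isom: "cinner (A (T f)) (T g) = cinner (A f) g" for f g
    by (simp add: sa cinner_cadjoint[OF bT] iso)
  \<comment> \<open>The orthogonal complement of the range of a self-adjoint operator is its
    kernel.\<close>
  have total: "s = 0" if "\<And>f. cinner (A f) s = 0" for s
  proof -
    have "A s = 0" by (rule cinner_left_eqI) (simp add: sa[symmetric] that)
    then show ?thesis using assms(3) by blast
  qed
  have bAT: "bounded_clinear (\<lambda>f. A (T f))" by (rule bounded_clinear_compose[OF bA bT])
  note lAT = bounded_clinear_imp_clinear[OF bAT]
  \<comment> \<open>No linearity or boundedness of \<open>g \<mapsto> s\<close> is demanded, so
    conditions stated vector by vector, such as range inclusions, can be compared with
    \<open>P\<close> directly.\<close>
  define P where "P \<longleftrightarrow> (\<forall>g. \<exists>s. \<forall>f. cinner (A (T f)) g = cinner (A f) s)"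

  \<comment> \<open>Adjointability and the pointwise condition\<close>
  have adjointable_P: "P" if "A_adjointable A T"
    using that unfolding A_adjointable_def A_inner_def P_def by blast
  have P_dominated: "\<exists>K>0. \<forall>f. norm (A (T f)) \<le> K * norm (A f)" if P
    by (rule pointwise_adjoint_imp_dominated[OF lA lAT assms(3)]) (use that P_def in blast)
  have dominated_adjointable: "A_adjointable A T"
    if K: "0 < K" "\<And>f. norm (A (T f)) \<le> K * norm (A f)" for K
    using dominated_imp_bounded_factor[OF lA lAT K total] bT
    unfolding A_adjointable_def A_inner_def by blast
  have P_iff: "A_adjointable A T \<longleftrightarrow> P"
    using adjointable_P P_dominated dominated_adjointable by blast

  \<comment> \<open>The adjoint of the isometric extension\<close>
  have "cadjoint V ` range \<iota> \<subseteq> range \<iota> \<longleftrightarrow> P"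
  proof -
    have "cadjoint V (\<iota> g) = \<iota> s \<longleftrightarrow> (\<forall>f. cinner (A (T f)) g = cinner (A f) s)" for g s
    proof
      assume "cadjoint V (\<iota> g) = \<iota> s"
      then show "\<forall>f. cinner (A (T f)) g = cinner (A f) s"
        by (metis cinner_cadjoint[OF bV] emb ext)
    next
      assume *: "\<forall>f. cinner (A (T f)) g = cinner (A f) s"
      show "cadjoint V (\<iota> g) = \<iota> s"
      \<comment> \<open>On vectors \<open>\<iota> f\<close> the two inner products agree by
        assumption; density and continuity carry this to every \<open>x\<close>.\<close>
      proof (rule cinner_left_eqI)
        fix x
        have "x \<in> closure (range \<iota>)" using dense by simp
        then obtain u where u: "\<And>n. u n \<in> range \<iota>" "u \<longlonglongrightarrow> x"
          unfolding closure_sequential by blast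
        have "cinner (u n) (cadjoint V (\<iota> g)) = cinner (u n) (\<iota> s)" for n
          using u(1)[of n] * by (auto simp: cinner_cadjoint[OF bV, symmetric] emb ext)
        moreover have "(\<lambda>n. cinner (u n) (cadjoint V (\<iota> g))) \<longlonglongrightarrow> cinner x (cadjoint V (\<iota> g))"
          and "(\<lambda>n. cinner (u n) (\<iota> s)) \<longlonglongrightarrow> cinner x (\<iota> s)"
          by (intro tendsto_cinner u(2) tendsto_const)+
        ultimately show "cinner x (cadjoint V (\<iota> g)) = cinner x (\<iota> s)"
          using LIMSEQ_unique by simp
      qed
    qed
    then show ?thesis unfolding P_def image_subset_iff by (auto simp: image_iff)
  qed

  \<comment> \<open>Ranges\<close>
  moreover have "range (cadjoint T \<circ> A) = range A \<longleftrightarrow> P"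
  proof -
    have "cadjoint T (A g) = A s \<longleftrightarrow> (\<forall>f. cinner (A (T f)) g = cinner (A f) s)" for g s
    proof -
      have "cinner (A (T f)) g = cinner f (cadjoint T (A g))" "cinner (A f) s = cinner f (A s)" for f
        by (simp_all add: sa cinner_cadjoint[OF bT])
      then show ?thesis using cinner_left_eqI by metis
    qed
    then have "range (cadjoint T \<circ> A) \<subseteq> range A \<longleftrightarrow> P"
      unfolding P_def by (auto simp: image_subset_iff image_iff)
    \<comment> \<open>This inclusion holds for every \<open>A\<close>-isometry: \<open>A f\<close>
      is the image of \<open>T f\<close>.\<close>
    moreover have "range A \<subseteq> range (cadjoint T \<circ> A)"
      using iso by (auto simp: image_iff) metis
    ultimately show ?thesis by blast
  qed

  \<comment> \<open>Compatibility of the range\<close>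
  moreover have "A_compatible A (range T)" if adj: "A_adjointable A T"
  proof -
    obtain S where bS: "bounded_clinear S" and S: "\<And>f g. cinner (A (T f)) g = cinner (A f) (S g)"
      using adj unfolding A_adjointable_def A_inner_def by blast
    note lS = bounded_clinear_imp_clinear[OF bS]
    \<comment> \<open>Thus \<open>T \<circ> S\<close> is a bounded idempotent with range
      \<open>range T\<close> and kernel \<open>{x. S x = 0}\<close>; the kernel is the required
      supplement.\<close>
    have ST: "S (T g) = g" for g
    proof -
      have "S (T g) - g = 0"
        by (rule total) (simp add: cinner_diff_right S[symmetric] isom)
      then show ?thesis by simp
    qed
    have closed_zero: "closed {x. F x = 0}" if "bounded_clinear F" for F :: "'h \<Rightarrow> 'h"
      using linear_continuous_on[OF bounded_clinear_imp_bounded_linear[OF that]]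
      by (intro closed_Collect_eq continuous_on_const)
    have bI: "bounded_clinear (\<lambda>x::'h. x)"
      by (simp add: bounded_clinear_iff clinear_def bounded_linear_ident)
    \<comment> \<open>Closedness follows by writing the range as the kernel of a bounded
      operator.\<close>
    have "range T = {x. x - T (S x) = 0}"
      using ST by (auto intro: range_eqI[of _ T])
    moreover have "closed {x. x - T (S x) = 0}"
      by (intro closed_zero bounded_clinear_diff bI bounded_clinear_compose[OF bT bS])
    ultimately have "closed (range T)" by simp
    moreover have "range T \<inter> {x. S x = 0} = {0}"
      using ST linear_0[OF clinear_imp_linear[OF lT]] linear_0[OF clinear_imp_linear[OF lS]]
      by (auto intro: range_eqI[of _ _ 0])
    moreover have "\<exists>s\<in>range T. \<exists>n\<in>{x. S x = 0}. h = s + n" for h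
      by (rule bexI[of _ "T (S h)"], rule bexI[of _ "h - T (S h)"])
         (simp_all add: linear_diff[OF clinear_imp_linear[OF lS]] ST)
    moreover have "\<forall>s\<in>range T. \<forall>n\<in>{x. S x = 0}. A_inner A s n = 0"
      by (auto simp: A_inner_def S)
    ultimately show ?thesis
      unfolding A_compatible_def
      using csubspace_range[OF lT] csubspace_kernel[OF lS] closed_zero[OF bS] by blast
  qed
  moreover have P if compat: "A_compatible A (range T)"
    unfolding P_def
  proof
    fix g
    \<comment> \<open>The witness is \<open>h\<close>: the part \<open>n\<close> drops out by
      orthogonality, and \<open>T\<close> preserves the \<open>A\<close>-inner product.\<close>
    obtain N h n where "n \<in> N" "g = T h + n" "\<forall>s\<in>range T. \<forall>n\<in>N. A_inner A s n = 0"
      using compat unfolding A_compatible_def by (metis imageE)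
    then have "\<forall>f. cinner (A (T f)) g = cinner (A f) h"
      by (simp add: cinner_add_right isom A_inner_def)
    then show "\<exists>s. \<forall>f. cinner (A (T f)) g = cinner (A f) s" by blast
  qed

  \<comment> \<open>The operator inequality\<close>
  moreover have op_le_iff: "op_le (cadjoint T \<circ> A \<circ> A \<circ> T) (\<lambda>f. lam *\<^sub>R A (A f)) \<longleftrightarrow>
      (\<forall>f. (norm (A (T f)))\<^sup>2 \<le> lam * (norm (A f))\<^sup>2)" for lam
  proof -
    have "bounded_clinear (\<lambda>f. lam *\<^sub>R A (A f) - cadjoint T (A (A (T f))))"
      by (intro bounded_clinear_diff bounded_clinear_scaleR bounded_clinear_compose[OF bA bA]
          bounded_clinear_compose[OF bounded_clinear_cadjoint[OF bT]]
          bounded_clinear_compose[OF bA bAT])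
    moreover have "cinner (lam *\<^sub>R A (A f) - cadjoint T (A (A (T f)))) f =
        of_real (lam * (norm (A f))\<^sup>2 - (norm (A (T f)))\<^sup>2)" for f
    proof -
      have "cinner (cadjoint T (A (A (T f)))) f = cnj (cinner (T f) (A (A (T f))))"
        by (metis cinner_cadjoint[OF bT] cinner_commute)
      then show ?thesis
        by (simp add: cinner_diff_left cinner_scaleR_left sa sa[symmetric, of "T f"] cinner_self)
    qed
    ultimately show ?thesis
      by (simp only: op_le_def positive_op_def comp_apply Reals_of_real Re_complex_of_real
          simp_thms diff_ge_0_iff_ge)
  qed
  have "\<exists>lam. 0 < lam \<and> op_le (cadjoint T \<circ> A \<circ> A \<circ> T) (\<lambda>f. lam *\<^sub>R A (A f))" if p: P
  proof -
    obtain K where K: "0 < K" "\<And>f. norm (A (T f)) \<le> K * norm (A f)"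
      using P_dominated[OF p] by blast
    \<comment> \<open>Squaring the norm estimate gives the constant \<open>K\<^sup>2\<close>; the
      converse below takes \<open>sqrt lam\<close>.\<close>
    then have "0 < K\<^sup>2" "\<And>f. (norm (A (T f)))\<^sup>2 \<le> K\<^sup>2 * (norm (A f))\<^sup>2"
      by (auto simp: power_mult_distrib[symmetric] intro: power_mono)
    then show ?thesis unfolding op_le_iff by blast
  qed
  moreover have "A_adjointable A T"
    if "0 < lam" "op_le (cadjoint T \<circ> A \<circ> A \<circ> T) (\<lambda>f. lam *\<^sub>R A (A f))" for lam
  proof (rule dominated_adjointable)
    show "0 < sqrt lam" using that by simp
    show "norm (A (T f)) \<le> sqrt lam * norm (A f)" for f
    proof (rule power2_le_imp_le)
      show "(norm (A (T f)))\<^sup>2 \<le> (sqrt lam * norm (A f))\<^sup>2"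
        using that op_le_iff by (simp add: power_mult_distrib)
    qed (use that in simp)
  qed
  ultimately show ?thesis using P_iff by blast
qed

end
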